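(* Let $X$ be an $\mathbb{N}$-valued random variable such that $X \in TN_2$ and $\mathrm{range}(X) = \{0,1,\ldots,r\}$ for some positive integer $r$. Then for all $n \in \mathbb{N}$ and all partitions $\lambda$ and $\mu$ of $n$, we have $\lambda \trianglerighteq \mu$ if and only if $C(\lambda,\mu,X)$ holds.
   Context: $\mathbb{N}$ denotes the set of non-negative integers. A partition is a non-increasing function $\lambda:\mathbb{N}\setminus\{0\}\to\mathbb{N}$ with finite support; its weight is $|\lambda|=\sum_i \lambda(i)$, and $\lambda$ is a partition of $n$ if $|\lambda|=n$. Dominance: $\lambda \trianglerighteq \mu$ (equivalently $\mu\trianglelefteq\lambda$) iff $|\lambda|=|\mu|$ and $\sum_{i=1}^j \lambda(i) \ge \sum_{i=1}^j \mu(i)$ for all positive integers $j$. For a real sequence $p=\{p_n\}_{n\ge 0}$ let $\mathcal{T}_p$ be the $\mathbb{N}\times\mathbb{N}$ matrix with $(\mathcal{T}_p)_{i,j}=p_{j-i}$, where $p_n=0$ for $n<0$. A matrix is $TN_k$ if all its minors of order at most $k$ are non-negative. For an $\mathbb{N}$-valued random variable $X$, let $p_X=\{P(X=n)\}_{n\ge0}$; $X\in TN_2$ means $\mathcal{T}_{p_X}\in TN_2$. $\mathrm{range}(X)=\{n\in\mathbb{N}: P(X=n)\neq 0\}$. For a partition $\nu$, let $Y_1,Y_2,\ldots$ be independent random variables, where $Y_i$ is distributed as the sum of $\nu(i)$ independent copies of $X$ (and $Y_i\equiv 0$ if $\nu(i)=0$). For $j,t\in\mathbb{N}$, $E(\nu,X,j,t)$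 is the event that $Y_i\le t$ for all $i\ge1$ and $\sum_{i\ge1} Y_i=j$. For partitions $\lambda,\mu$, $C(\lambda,\mu,X)$ is the condition that $P(E(\lambda,X,j,t))\le P(E(\mu,X,j,t))$ for all $j,t\in\mathbb{N}$. *)

theory Defs
  imports "Jordan_Normal_Form.Determinant" "HOL-Probability.Probability"
begin

text \<open>
  A partition is a function on the positive integers. It is represented by a function on all
  of \<^typ>\<open>nat\<close>, and no definition below looks at its value at \<open>0\<close>.
\<close>

definition is_partition :: "(nat \<Rightarrow> nat) \<Rightarrow> bool" where
  "is_partition \<nu> \<longleftrightarrow> antimono_on {1..} \<nu> \<and> finite {i \<in> {1..}. \<nu> i \<noteq> 0}"

definition weight :: "(nat \<Rightarrow> nat) \<Rightarrow> nat" where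
  "weight \<nu> = (\<Sum>i \<in> {i \<in> {1..}. \<nu> i \<noteq> 0}. \<nu> i)"

definition partition_of :: "(nat \<Rightarrow> nat) \<Rightarrow> nat \<Rightarrow> bool" where
  "partition_of \<nu> n \<longleftrightarrow> is_partition \<nu> \<and> weight \<nu> = n"

definition dominates :: "(nat \<Rightarrow> nat) \<Rightarrow> (nat \<Rightarrow> nat) \<Rightarrow> bool" where
  "dominates \<kappa> \<mu> \<longleftrightarrow>
     weight \<kappa> = weight \<mu> \<and> (\<forall>j\<ge>1. (\<Sum>i=1..j. \<mu> i) \<le> (\<Sum>i=1..j. \<kappa> i))"

definition toeplitz :: "(nat \<Rightarrow> real) \<Rightarrow> nat \<Rightarrow> nat \<Rightarrow> real" where
  "toeplitz p i j = (if i \<le> j then p (j - i) else 0)"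

text \<open>
  The rows and columns of a minor of order \<open>m\<close> are enumerated increasingly by \<open>I\<close> and \<open>J\<close>.
\<close>

definition TN :: "nat \<Rightarrow> (nat \<Rightarrow> nat \<Rightarrow> real) \<Rightarrow> bool" where
  "TN k A \<longleftrightarrow> (\<forall>m I J. 1 \<le> m \<and> m \<le> k \<and> strict_mono_on {..<m} I \<and> strict_mono_on {..<m} J
     \<longrightarrow> 0 \<le> Determinant.det (Matrix.mat m m (\<lambda>(a, b). A (I a) (J b))))"

definition prob_seq :: "'a measure \<Rightarrow> ('a \<Rightarrow> nat) \<Rightarrow> nat \<Rightarrow> real" where
  "prob_seq M X n = measure M {\<omega> \<in> space M. X \<omega> = n}"

definition rv_range :: "'a measure \<Rightarrow> ('a \<Rightarrow> nat) \<Rightarrow> nat set" where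
  "rv_range M X = {n. prob_seq M X n \<noteq> 0}"

text \<open>
  The canonical space carrying independent copies \<open>\<omega> (i, k)\<close> of \<open>X\<close>. The variable \<open>Y\<^sub>i\<close> is the
  sum of the first \<open>\<nu> i\<close> copies in row \<open>i\<close>; in particular it is identically \<open>0\<close> if \<open>\<nu> i = 0\<close>.
\<close>

definition copies :: "'a measure \<Rightarrow> ('a \<Rightarrow> nat) \<Rightarrow> (nat \<times> nat \<Rightarrow> nat) measure" where
  "copies M X = (\<Pi>\<^sub>M ik\<in>UNIV. distr M (count_space UNIV) X)"

definition row_sum :: "(nat \<Rightarrow> nat) \<Rightarrow> nat \<Rightarrow> (nat \<times> nat \<Rightarrow> nat) \<Rightarrow> nat" where
  "row_sum \<nu> i \<omega> = (\<Sum>k<\<nu> i. \<omega> (i, k))"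

text \<open>
  The sum of all \<open>Y\<^sub>i\<close> is taken over the support of \<open>\<nu>\<close>, outside of which \<open>Y\<^sub>i\<close> vanishes.
\<close>

definition event_E ::
    "(nat \<Rightarrow> nat) \<Rightarrow> 'a measure \<Rightarrow> ('a \<Rightarrow> nat) \<Rightarrow> nat \<Rightarrow> nat \<Rightarrow> (nat \<times> nat \<Rightarrow> nat) set" where
  "event_E \<nu> M X j t = {\<omega> \<in> space (copies M X).
     (\<forall>i\<ge>1. row_sum \<nu> i \<omega> \<le> t) \<and> (\<Sum>i \<in> {i \<in> {1..}. \<nu> i \<noteq> 0}. row_sum \<nu> i \<omega>) = j}"

lemma prob_space_copies:
  assumes "prob_space M" "X \<in> measurable M (count_space UNIV)"
  shows "prob_space (copies M X)"
  unfolding copies_def using assms by (intro prob_space_PiM prob_space.prob_space_distr)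

lemma measurable_coordinate:
  "(\<lambda>\<omega>. \<omega> ik) \<in> measurable (copies M X) (count_space UNIV)"
proof -
  have "(\<lambda>\<omega>. \<omega> ik) \<in> measurable (copies M X) (distr M (count_space UNIV) X)"
    unfolding copies_def by (rule measurable_component_singleton) simp
  then show ?thesis by simp
qed

lemma distr_coordinate:
  assumes "prob_space M" "X \<in> measurable M (count_space UNIV)"
  shows "distr (copies M X) (count_space UNIV) (\<lambda>\<omega>. \<omega> ik) = distr M (count_space UNIV) X"
proof -
  have "distr (copies M X) (distr M (count_space UNIV) X) (\<lambda>\<omega>. \<omega> ik)
      = distr M (count_space UNIV) X"
    unfolding copies_def using assms
    by (intro distr_PiM_component prob_space.prob_space_distr) auto
  moreover have "distr (copies M X) (distr M (count_space UNIV) X) (\<lambda>\<omega>. \<omega> ik)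
      = distr (copies M X) (count_space UNIV) (\<lambda>\<omega>. \<omega> ik)"
    by (rule distr_cong) auto
  ultimately show ?thesis by simp
qed

lemma indep_coordinates:
  assumes "prob_space M" "X \<in> measurable M (count_space UNIV)"
  shows "prob_space.indep_vars (copies M X) (\<lambda>_. count_space UNIV) (\<lambda>ik \<omega>. \<omega> ik) UNIV"
proof -
  interpret prob_space "copies M X" using assms by (rule prob_space_copies)
  have "distr (copies M X) (\<Pi>\<^sub>M ik\<in>UNIV. count_space UNIV) (\<lambda>\<omega>. \<lambda>ik\<in>UNIV. \<omega> ik)
      = distr (copies M X) (copies M X) (\<lambda>\<omega>. \<omega>)"
    by (intro distr_cong) (auto simp: copies_def intro!: sets_PiM_cong)
  also have "\<dots> = (\<Pi>\<^sub>M ik\<in>UNIV. distr (copies M X) (count_space UNIV) (\<lambda>\<omega>. \<omega> ik))"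
    unfolding distr_coordinate[OF assms] by (simp add: distr_id2 copies_def)
  finally show ?thesis
    by (subst indep_vars_iff_distr_eq_PiM) (auto intro: measurable_coordinate)
qed

lemma indep_row_sums:
  assumes "prob_space M" "X \<in> measurable M (count_space UNIV)"
  shows "prob_space.indep_vars (copies M X) (\<lambda>_. count_space UNIV) (row_sum \<nu>) UNIV"
proof -
  interpret prob_space "copies M X" using assms by (rule prob_space_copies)
  let ?K = "\<lambda>i. {i} \<times> (UNIV :: nat set)"
  let ?R = "\<lambda>i (\<omega> :: nat \<times> nat \<Rightarrow> nat). restrict \<omega> (?K i)"
  have "indep_vars (\<lambda>i. Pi\<^sub>M (?K i) (\<lambda>_. count_space UNIV)) ?R UNIV"
    by (rule indep_vars_restrict[OF indep_coordinates[OF assms]])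
       (auto simp: disjoint_family_on_def)
  then have "indep_vars (\<lambda>_. count_space UNIV) (\<lambda>i \<omega>. row_sum \<nu> i (?R i \<omega>)) UNIV"
  proof (rule indep_vars_compose2)
    fix i :: nat
    show "row_sum \<nu> i \<in> measurable (Pi\<^sub>M (?K i) (\<lambda>_. count_space UNIV)) (count_space UNIV)"
      unfolding row_sum_def by measurable
  qed
  then show ?thesis by (simp add: row_sum_def[abs_def])
qed

lemma event_E_sets: "event_E \<nu> M X j t \<in> sets (copies M X)"
proof -
  have [measurable]: "row_sum \<nu> i \<in> measurable (copies M X) (count_space UNIV)" for i
    using measurable_coordinate[measurable] unfolding row_sum_def by measurable
  show ?thesis unfolding event_E_def by measurable
qed

definition cond_C :: "(nat \<Rightarrow> nat) \<Rightarrow> (nat \<Rightarrow> nat) \<Rightarrow> 'a measure \<Rightarrow> ('a \<Rightarrow> nat) \<Rightarrow> bool" where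
  "cond_C \<kappa> \<mu> M X \<longleftrightarrow> (\<forall>j t. measure (copies M X) (event_E \<kappa> M X j t)
     \<le> measure (copies M X) (event_E \<mu> M X j t))"

end

theory Submission
  imports Defs
begin

text \<open>
  If \<open>P\<close> is the generating function of \<open>X\<close>, then the probability of \<open>E(\<nu>, X, j, t)\<close> is the
  coefficient at \<open>j\<close> of the product of the polynomials \<open>P ^ \<nu> i\<close> truncated after degree \<open>t\<close>.
  Dominance is generated by moving a box from a longer to a shorter row. In such a move, condition
  on the value \<open>x\<close> of the summand that is moved: this lowers the truncation degree of its row to
  \<open>t - x\<close>, and the gain is a sum of terms \<open>g a * h b - g b * h a\<close> with \<open>a \<le> t - x < b\<close>, where \<open>g\<close> and
  \<open>h\<close> are the laws of sums of \<open>l \<le> m\<close> copies of \<open>X\<close>. These terms are non-negative since \<open>X\<close>, and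
  hence each of its convolution powers, is log-concave. Conversely, for \<open>t = r * s\<close> the product has
  degree \<open>r\<close> times the sum of all \<open>min s (\<nu> i)\<close>, so \<open>C\<close> compares the conjugate partitions.
\<close>

section \<open>Toeplitz matrices and log-concavity\<close>

text \<open>Repeated rows or columns are allowed and give equality, so that minors can be summed
  without excluding them.\<close>

definition toeplitz_tn2 :: "real fps \<Rightarrow> bool" where
  "toeplitz_tn2 G \<longleftrightarrow> (\<forall>i i' j j'. i \<le> i' \<longrightarrow> j \<le> j' \<longrightarrow>
     toeplitz (fps_nth G) i j' * toeplitz (fps_nth G) i' j
       \<le> toeplitz (fps_nth G) i j * toeplitz (fps_nth G) i' j')"

lemma det_mat_2:
  "Determinant.det (Matrix.mat 2 2 f) = f (0, 0) * f (1, 1) - f (0, 1) * (f (1, 0) :: real)"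
proof -
  have d: "Determinant.det (mat_delete (Matrix.mat 2 2 f) 0 j) = f (1, 1 - j)" if "j < 2" for j
    using that by (subst det_single) (auto simp: mat_delete_def less_2_cases_iff)
  have "Determinant.det (Matrix.mat 2 2 f)
      = (\<Sum>j<2. Matrix.mat 2 2 f $$ (0, j) * cofactor (Matrix.mat 2 2 f) 0 j)"
    by (rule laplace_expansion_row) auto
  then show ?thesis by (simp add: numeral_2_eq_2 cofactor_def d[unfolded numeral_2_eq_2])
qed

lemma TN2_imp_toeplitz_tn2:
  assumes "TN 2 (toeplitz (fps_nth G))"
  shows "toeplitz_tn2 G"
  unfolding toeplitz_tn2_def
proof (intro allI impI)
  fix i i' j j' :: nat
  let ?T = "toeplitz (fps_nth G)"
  assume le: "i \<le> i'" "j \<le> j'"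
  show "?T i j' * ?T i' j \<le> ?T i j * ?T i' j'"
  proof (cases "i = i' \<or> j = j'")
    case False
    let ?I = "\<lambda>a::nat. if a = 0 then i else i'" and ?J = "\<lambda>a::nat. if a = 0 then j else j'"
    have "strict_mono_on {..<2} ?I" "strict_mono_on {..<2} ?J"
      using le False by (auto simp: strict_mono_on_def)
    then have "0 \<le> Determinant.det (Matrix.mat 2 2 (\<lambda>(a, b). ?T (?I a) (?J b)))"
      using assms unfolding TN_def by (metis one_le_numeral order_refl)
    then show ?thesis by (simp add: det_mat_2)
  qed (auto simp: mult.commute)
qed

text \<open>Multiplying series multiplies their Toeplitz matrices. These are upper triangular, so
  the finite range \<open>k < N\<close> with \<open>j < N\<close> loses nothing.\<close>

lemma toeplitz_fps_mult:
  fixes F G :: "real fps"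
  assumes "j < N"
  shows "toeplitz (fps_nth (F * G)) i j
    = (\<Sum>k<N. toeplitz (fps_nth F) i k * toeplitz (fps_nth G) k j)"
proof (cases "i \<le> j")
  case True
  have "(\<Sum>k<N. toeplitz (fps_nth F) i k * toeplitz (fps_nth G) k j)
      = (\<Sum>k=i..j. fps_nth F (k - i) * fps_nth G (j - k))"
    using assms by (intro sum.mono_neutral_cong_right) (auto simp: toeplitz_def)
  also have "\<dots> = (\<Sum>a=0..j-i. fps_nth F a * fps_nth G (j - i - a))"
    using True by (intro sum.reindex_bij_witness[of _ "\<lambda>a. a + i" "\<lambda>k. k - i"]) auto
  finally show ?thesis using True by (simp add: toeplitz_def fps_mult_nth)
qed (auto simp: toeplitz_def intro!: sum.neutral)

text \<open>The Cauchy--Binet expansion, summed over ordered pairs \<open>(k, l)\<close>.\<close>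

lemma cauchy_binet_2:
  fixes A B C D :: "'i \<Rightarrow> real"
  assumes "\<And>k l. k \<in> I \<Longrightarrow> l \<in> I \<Longrightarrow> 0 \<le> (A k * B l - A l * B k) * (C k * D l - C l * D k)"
  shows "(\<Sum>k\<in>I. A k * D k) * (\<Sum>l\<in>I. B l * C l) \<le> (\<Sum>k\<in>I. A k * C k) * (\<Sum>l\<in>I. B l * D l)"
proof -
  have "0 \<le> (\<Sum>k\<in>I. \<Sum>l\<in>I. (A k * B l - A l * B k) * (C k * D l - C l * D k))"
    using assms by (intro sum_nonneg) auto
  also have "\<dots> = (\<Sum>k\<in>I. \<Sum>l\<in>I. (A k * C k) * (B l * D l)) - (\<Sum>k\<in>I. \<Sum>l\<in>I. (A k * D k) * (B l * C l))
      - (\<Sum>k\<in>I. \<Sum>l\<in>I. (B k * C k) * (A l * D l)) + (\<Sum>k\<in>I. \<Sum>l\<in>I. (B k * D k) * (A l * C l))"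
    by (simp add: sum.distrib[symmetric] sum_subtractf[symmetric] algebra_simps)
  \<comment> \<open>Exchanging \<open>k\<close> and \<open>l\<close> identifies the four double sums
    in pairs.\<close>
  also have "\<dots> = 2 * ((\<Sum>k\<in>I. A k * C k) * (\<Sum>l\<in>I. B l * D l)
      - (\<Sum>k\<in>I. A k * D k) * (\<Sum>l\<in>I. B l * C l))"
    by (simp add: sum_product[symmetric])
  finally show ?thesis by simp
qed

text \<open>By Cauchy--Binet, a minor of the product is a sum of products of minors of the
  factors.\<close>

lemma toeplitz_tn2_mult:
  assumes "toeplitz_tn2 F" "toeplitz_tn2 G"
  shows "toeplitz_tn2 (F * G)"
  unfolding toeplitz_tn2_def
proof (intro allI impI)
  fix i i' j j' :: nat
  assume le: "i \<le> i'" "j \<le> j'"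
  let ?F = "toeplitz (fps_nth F)" and ?G = "toeplitz (fps_nth G)"
  have ord: "0 \<le> ?F i k * ?F i' l - ?F i l * ?F i' k"
    "0 \<le> ?G k j * ?G l j' - ?G l j * ?G k j'" if "k \<le> l" for k l
  proof -
    have "?F i l * ?F i' k \<le> ?F i k * ?F i' l" "?G k j' * ?G l j \<le> ?G k j * ?G l j'"
      using assms le that unfolding toeplitz_tn2_def by blast+
    then show "0 \<le> ?F i k * ?F i' l - ?F i l * ?F i' k"
      "0 \<le> ?G k j * ?G l j' - ?G l j * ?G k j'" by (simp_all add: mult.commute)
  qed
  have "0 \<le> (?F i k * ?F i' l - ?F i l * ?F i' k) * (?G k j * ?G l j' - ?G l j * ?G k j')" for k l
  proof (cases "k \<le> l")
    case True
    then show ?thesis using ord by simp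
  next
    case False
    \<comment> \<open>For \<open>k > l\<close> both factors change sign, so their product does
      not.\<close>
    then have "0 \<le> (?F i l * ?F i' k - ?F i k * ?F i' l) * (?G l j * ?G k j' - ?G k j * ?G l j')"
      using ord[of l k] by simp
    then show ?thesis by (simp add: algebra_simps)
  qed
  then show "toeplitz (fps_nth (F * G)) i j' * toeplitz (fps_nth (F * G)) i' j
      \<le> toeplitz (fps_nth (F * G)) i j * toeplitz (fps_nth (F * G)) i' j'"
    unfolding toeplitz_fps_mult[of j "Suc j'", OF le_imp_less_Suc[OF le(2)]]
      toeplitz_fps_mult[of j' "Suc j'", OF lessI]
    by (intro cauchy_binet_2) auto
qed

lemma toeplitz_tn2_one: "toeplitz_tn2 1"
  by (auto simp: toeplitz_tn2_def toeplitz_def)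

lemma toeplitz_tn2_power: "toeplitz_tn2 F \<Longrightarrow> toeplitz_tn2 (F ^ m)"
  by (induction m) (auto intro: toeplitz_tn2_mult toeplitz_tn2_one)

section \<open>Coefficientwise comparison of truncated products\<close>

definition fps_nonneg :: "real fps \<Rightarrow> bool" where
  "fps_nonneg F \<longleftrightarrow> (\<forall>n. 0 \<le> fps_nth F n)"

lemma fps_nonneg_mult: "fps_nonneg F \<Longrightarrow> fps_nonneg G \<Longrightarrow> fps_nonneg (F * G)"
  by (auto simp: fps_nonneg_def fps_mult_nth intro!: sum_nonneg)

lemma fps_nonneg_one: "fps_nonneg 1"
  by (simp add: fps_nonneg_def fps_one_nth)

lemma fps_nonneg_power: "fps_nonneg F \<Longrightarrow> fps_nonneg (F ^ m)"
  by (induction m) (auto intro: fps_nonneg_mult fps_nonneg_one)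

lemma fps_nonneg_prod: "(\<And>i. i \<in> I \<Longrightarrow> fps_nonneg (F i)) \<Longrightarrow> fps_nonneg (\<Prod>i\<in>I. F i)"
  by (induction I rule: infinite_finite_induct) (auto intro: fps_nonneg_mult fps_nonneg_one)

lemma fps_nonneg_sum: "(\<And>i. i \<in> I \<Longrightarrow> fps_nonneg (F i)) \<Longrightarrow> fps_nonneg (\<Sum>i\<in>I. F i)"
  by (induction I rule: infinite_finite_induct) (auto simp: fps_nonneg_def)

lemma fps_nonneg_cutoff: "fps_nonneg F \<Longrightarrow> fps_nonneg (fps_cutoff t F)"
  by (simp add: fps_nonneg_def)

text \<open>The variable with generating function \<open>G\<close> is below the one with \<open>G * H\<close> in the
  likelihood ratio order.\<close>

lemma likelihood_ratio:
  assumes "toeplitz_tn2 G" "fps_nonneg G" "fps_nonneg H" "a \<le> b"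
  shows "fps_nth G b * fps_nth (G * H) a \<le> fps_nth G a * fps_nth (G * H) b"
proof -
  have "fps_nth G b * fps_nth (H * G) a
      = (\<Sum>y=0..a. fps_nth H y * (fps_nth G b * fps_nth G (a - y)))"
    unfolding fps_mult_nth sum_distrib_left by (intro sum.cong) (auto simp: algebra_simps)
  also have "\<dots> \<le> (\<Sum>y=0..a. fps_nth H y * (fps_nth G a * fps_nth G (b - y)))"
  proof (intro sum_mono mult_left_mono)
    fix y assume y: "y \<in> {0..a}"
    \<comment> \<open>The minor with rows \<open>0\<close>, \<open>y\<close> and columns
      \<open>a\<close>, \<open>b\<close>; since \<open>y \<le> a\<close>, no entry is a padding
      zero.\<close>
    have "toeplitz (fps_nth G) 0 b * toeplitz (fps_nth G) y a
        \<le> toeplitz (fps_nth G) 0 a * toeplitz (fps_nth G) y b"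
      using assms unfolding toeplitz_tn2_def by blast
    then show "fps_nth G b * fps_nth G (a - y) \<le> fps_nth G a * fps_nth G (b - y)"
      using y assms by (simp add: toeplitz_def)
  qed (use assms in \<open>auto simp: fps_nonneg_def\<close>)
  also have "\<dots> \<le> (\<Sum>y=0..b. fps_nth H y * (fps_nth G a * fps_nth G (b - y)))"
    using assms by (intro sum_mono2) (auto simp: fps_nonneg_def)
  also have "\<dots> = fps_nth G a * fps_nth (H * G) b"
    unfolding fps_mult_nth sum_distrib_left by (intro sum.cong) (auto simp: algebra_simps)
  finally show ?thesis by (simp add: mult.commute)
qed

text \<open>Condition on the value \<open>x\<close> of the summand with generating function
  \<open>P\<close>: the rest may be at most \<open>t - x\<close>. Note that
  \<open>fps_cutoff (Suc t)\<close> keeps the degrees up to \<open>t\<close>.\<close>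

lemma cutoff_mult_eq_sum:
  fixes F P :: "real fps"
  shows "fps_cutoff (Suc t) (F * P)
    = (\<Sum>x\<le>t. fps_const (fps_nth P x) * fps_X ^ x * fps_cutoff (Suc t - x) F)"
proof (rule fps_ext)
  fix n
  have "(\<Sum>x\<le>t. fps_nth (fps_const (fps_nth P x) * fps_X ^ x * fps_cutoff (Suc t - x) F) n)
      = (if n \<le> t then \<Sum>x=0..n. fps_nth P x * fps_nth F (n - x) else 0)"
    unfolding mult.assoc fps_mult_left_const_nth fps_X_power_mult_nth fps_cutoff_nth
    by (auto intro!: sum.mono_neutral_cong_right sum.neutral)
  also have "\<dots> = fps_nth (fps_cutoff (Suc t) (F * P)) n"
    by (simp add: mult.commute[of F] fps_mult_nth less_Suc_eq_le)
  finally show "fps_nth (fps_cutoff (Suc t) (F * P)) n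
      = fps_nth (\<Sum>x\<le>t. fps_const (fps_nth P x) * fps_X ^ x * fps_cutoff (Suc t - x) F) n"
    by (simp add: fps_sum_nth)
qed

text \<open>Splitting \<open>fps_cutoff v\<close> at \<open>u\<close>, the terms with both exponents below \<open>u\<close> cancel, and in the
  remaining ones the exponents are ordered.\<close>

lemma cutoff_exchange:
  assumes lr: "\<And>a b. a \<le> b \<Longrightarrow> fps_nth G b * fps_nth H a \<le> fps_nth G a * fps_nth H b"
    and "u \<le> v"
  shows "fps_nonneg (fps_cutoff u G * fps_cutoff v H - fps_cutoff v G * fps_cutoff u H)"
proof -
  define mid where "mid K = fps_cutoff v K - fps_cutoff u K" for K :: "real fps"
  have mid: "fps_nth (mid K) n = (if u \<le> n \<and> n < v then fps_nth K n else 0)" for K n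
    using \<open>u \<le> v\<close> by (auto simp: mid_def)
  have "fps_cutoff u G * fps_cutoff v H - fps_cutoff v G * fps_cutoff u H
      = fps_cutoff u G * mid H - fps_cutoff u H * mid G"
    by (simp add: mid_def algebra_simps)
  also have "fps_nonneg \<dots>"
    unfolding fps_nonneg_def fps_sub_nth fps_mult_nth sum_subtractf[symmetric]
    using lr by (auto simp: mid intro!: sum_nonneg) (metis mult.commute less_le_trans less_imp_le)
  finally show ?thesis .
qed

lemma fps_nonneg_shift_mult:
  assumes "fps_nonneg F" "0 \<le> c"
  shows "fps_nonneg (fps_const c * fps_X ^ x * F)"
  using assms unfolding fps_nonneg_def mult.assoc fps_mult_left_const_nth fps_X_power_mult_nth
  by simp

text \<open>One copy moves from a row of \<open>Suc m\<close> copies to a row of \<open>l\<close>.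
  For each value \<open>x\<close> of that copy, \<open>cutoff_exchange\<close> applies with
  \<open>u = Suc t - x\<close> and \<open>v = Suc t\<close>.\<close>

lemma cutoff_power_exchange:
  assumes P: "toeplitz_tn2 P" "fps_nonneg P" and "l \<le> m"
  shows "fps_nonneg (fps_cutoff (Suc t) (P ^ Suc l) * fps_cutoff (Suc t) (P ^ m)
    - fps_cutoff (Suc t) (P ^ l) * fps_cutoff (Suc t) (P ^ Suc m))"
proof -
  let ?c = "fps_cutoff (Suc t)" and ?M = "\<lambda>x. fps_const (fps_nth P x) * fps_X ^ x"
  \<comment> \<open>Thus \<open>P ^ m\<close> is \<open>P ^ l\<close> times the non-negative
    \<open>P ^ d\<close>, the form that \<open>likelihood_ratio\<close> compares with
    \<open>P ^ l\<close>.\<close>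
  obtain d where m: "m = l + d" using \<open>l \<le> m\<close> le_Suc_ex by blast
  have lr: "fps_nth (P ^ l) b * fps_nth (P ^ m) a \<le> fps_nth (P ^ l) a * fps_nth (P ^ m) b"
    if "a \<le> b" for a b
    unfolding m power_add using P that
    by (intro likelihood_ratio toeplitz_tn2_power fps_nonneg_power)
  have "?c (P ^ l * P) * ?c (P ^ m) - ?c (P ^ l) * ?c (P ^ m * P)
      = (\<Sum>x\<le>t. ?M x * (fps_cutoff (Suc t - x) (P ^ l) * ?c (P ^ m)
          - ?c (P ^ l) * fps_cutoff (Suc t - x) (P ^ m)))"
    unfolding cutoff_mult_eq_sum
    by (simp add: sum_distrib_left sum_distrib_right sum_subtractf[symmetric] algebra_simps)
  also have "fps_nonneg \<dots>"
    using P(2) lr by (intro fps_nonneg_sum fps_nonneg_shift_mult cutoff_exchange)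
      (auto simp: fps_nonneg_def)
  finally show ?thesis by (simp only: power_Suc2)
qed

section \<open>Dominance\<close>

text \<open>Boxes are moved one at a time. Only \<open>\<mu>\<close> has to be non-increasing, so the intermediate
  functions need not be partitions.\<close>

lemma dominance_box_moves:
  fixes \<Phi> :: "(nat \<Rightarrow> nat) \<Rightarrow> real"
  assumes cong: "\<And>\<nu> \<nu>'. (\<And>i. i \<in> {1..N} \<Longrightarrow> \<nu> i = \<nu>' i) \<Longrightarrow> \<Phi> \<nu> = \<Phi> \<nu>'"
    and move: "\<And>\<nu> i k. i \<in> {1..N} \<Longrightarrow> k \<in> {1..N} \<Longrightarrow> \<nu> k + 2 \<le> \<nu> i
      \<Longrightarrow> \<Phi> \<nu> \<le> \<Phi> (\<nu>(i := \<nu> i - 1, k := \<nu> k + 1))"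
    and anti: "antimono_on {1..N} \<mu>"
    and dom: "\<And>j. j \<le> N \<Longrightarrow> (\<Sum>i=1..j. \<mu> i) \<le> (\<Sum>i=1..j. \<kappa> i)"
    and total: "(\<Sum>i=1..N. \<kappa> i) = (\<Sum>i=1..N. \<mu> i)"
  shows "\<Phi> \<kappa> \<le> \<Phi> \<mu>"
  using dom total
\<comment> \<open>The sum of all partial sums of \<open>\<kappa>\<close> drops with every
  move.\<close>
proof (induction "\<Sum>j\<le>N. \<Sum>i=1..j. \<kappa> i" arbitrary: \<kappa> rule: less_induct)
  case less
  define S where "S \<nu> j = (\<Sum>i=1..j. \<nu> i)" for \<nu> :: "nat \<Rightarrow> nat" and j :: nat
  have S0: "S \<nu> 0 = 0" and S_Suc: "S \<nu> (Suc j) = S \<nu> j + \<nu> (Suc j)" for \<nu> j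
    by (simp_all add: S_def)
  have dom: "S \<mu> j \<le> S \<kappa> j" if "j \<le> N" for j using less.prems(1) that by (simp add: S_def)
  have total: "S \<kappa> N = S \<mu> N" using less.prems(2) by (simp add: S_def)
  show ?case
  proof (cases "\<exists>j\<le>N. S \<kappa> j \<noteq> S \<mu> j")
    case False
    have "\<kappa> i = \<mu> i" if "i \<in> {1..N}" for i
      using that False S_Suc[of \<kappa> "i - 1"] S_Suc[of \<mu> "i - 1"]
      by (metis Suc_leD add_left_cancel atLeastAtMost_iff le_add_diff_inverse plus_1_eq_Suc)
    then show ?thesis using cong by (metis order_refl)
  next
    case True
    \<comment> \<open>At \<open>i\<close> the partial sums first differ; at \<open>k\<close> they
      next agree again. So row \<open>i\<close> of \<open>\<kappa>\<close> is too long and row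
      \<open>k\<close> too short.\<close>
    define i where "i = (LEAST j. j \<le> N \<and> S \<kappa> j \<noteq> S \<mu> j)"
    have i: "i \<le> N" "S \<kappa> i \<noteq> S \<mu> i"
      using LeastI_ex[OF True] by (auto simp: i_def)
    have i_min: "S \<kappa> j = S \<mu> j" if "j < i" for j
      using not_less_Least[of j "\<lambda>j. j \<le> N \<and> S \<kappa> j \<noteq> S \<mu> j"] that i(1) by (auto simp: i_def)
    define k where "k = (LEAST j. i < j \<and> S \<kappa> j = S \<mu> j)"
    have "i < N" using i total by (metis le_neq_implies_less)
    then have ex: "\<exists>j. i < j \<and> S \<kappa> j = S \<mu> j" using total by blast
    have k: "i < k" "S \<kappa> k = S \<mu> k" using LeastI_ex[OF ex] by (auto simp: k_def)
    have "k \<le> N" unfolding k_def using \<open>i < N\<close> total by (intro Least_le) auto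
    have k_min: "S \<kappa> j \<noteq> S \<mu> j" if "i < j" "j < k" for j
      using not_less_Least[of j "\<lambda>j. i < j \<and> S \<kappa> j = S \<mu> j"] that by (auto simp: k_def)
    have between: "S \<mu> j < S \<kappa> j" if "i \<le> j" "j < k" for j
      using that i k_min[of j] dom[of j] \<open>k \<le> N\<close>
      by (metis le_neq_implies_less less_imp_le order_less_le_trans)
    have "1 \<le> i" using i(2) by (cases i) (auto simp: S0)
    obtain i' where i': "i = Suc i'" using \<open>1 \<le> i\<close> by (cases i) auto
    obtain k' where k': "k = Suc k'" using k by (cases k) auto
    have "\<mu> i < \<kappa> i"
      using between[of i] i_min[of i'] k S_Suc[of \<kappa> i'] S_Suc[of \<mu> i'] by (simp add: i')
    moreover have "\<kappa> k < \<mu> k"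
      using between[of k'] k S_Suc[of \<kappa> k'] S_Suc[of \<mu> k'] by (simp add: k')
    \<comment> \<open>As \<open>\<mu>\<close> is non-increasing, the two strict inequalities add up
      to a gap of at least 2.\<close>
    moreover have "\<mu> k \<le> \<mu> i"
      using anti \<open>1 \<le> i\<close> k(1) \<open>k \<le> N\<close> by (auto simp: monotone_on_def)
    ultimately have gap: "\<kappa> k + 2 \<le> \<kappa> i" by simp
    define \<kappa>' where "\<kappa>' = \<kappa>(i := \<kappa> i - 1, k := \<kappa> k + 1)"
    \<comment> \<open>Only the partial sums with \<open>i \<le> j < k\<close> drop, each by one, and
      there \<open>\<kappa>\<close> was strictly ahead, so dominance survives.\<close>
    have S': "S \<kappa>' j + (if i \<le> j \<and> j < k then 1 else 0) = S \<kappa> j" for j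
    proof (induction j)
      case (Suc j)
      then show ?case using gap k(1) by (auto simp: S_Suc \<kappa>'_def split: if_splits)
    qed (use \<open>1 \<le> i\<close> in \<open>auto simp: S0\<close>)
    have "S \<mu> j \<le> S \<kappa>' j" if "j \<le> N" for j
      using S'[of j] dom[OF that] between[of j] by (auto split: if_splits)
    moreover have "S \<kappa>' N = S \<mu> N"
      using S'[of N] total \<open>k \<le> N\<close> by auto
    moreover have "(\<Sum>j\<le>N. S \<kappa>' j) < (\<Sum>j\<le>N. S \<kappa> j)"
    proof (rule sum_strict_mono_ex1)
      show "\<forall>j\<in>{..N}. S \<kappa>' j \<le> S \<kappa> j" using S' by (metis le_add1)
      show "\<exists>j\<in>{..N}. S \<kappa>' j < S \<kappa> j" using S'[of i] i(1) k(1) by (auto intro!: bexI[of _ i])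
    qed simp
    ultimately have "\<Phi> \<kappa>' \<le> \<Phi> \<mu>" by (intro less.hyps) (auto simp: S_def)
    moreover have "\<Phi> \<kappa> \<le> \<Phi> \<kappa>'"
      unfolding \<kappa>'_def using gap \<open>1 \<le> i\<close> i k(1) \<open>k \<le> N\<close> by (intro move) auto
    ultimately show ?thesis by simp
  qed
qed

text \<open>The hypothesis compares the partial sums of the conjugate partitions.\<close>

lemma dominance_if_sum_min_le:
  fixes \<kappa> \<mu> :: "nat \<Rightarrow> nat"
  assumes anti: "antimono_on {1..N} \<kappa>"
    and total: "(\<Sum>i=1..N. \<kappa> i) = (\<Sum>i=1..N. \<mu> i)"
    and min_le: "\<And>s. (\<Sum>i=1..N. min s (\<kappa> i)) \<le> (\<Sum>i=1..N. min s (\<mu> i))"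
    and j: "1 \<le> j" "j \<le> N"
  shows "(\<Sum>i=1..j. \<mu> i) \<le> (\<Sum>i=1..j. \<kappa> i)"
proof -
  \<comment> \<open>For this \<open>s\<close>, capping turns the first \<open>j\<close> rows of
    \<open>\<kappa>\<close> into \<open>s\<close> and leaves the later ones unchanged. For
    \<open>\<mu>\<close> these values are upper bounds, so the tail of \<open>\<kappa>\<close> is at
    most that of \<open>\<mu>\<close>.\<close>
  define s where "s = \<kappa> j"
  have split: "(\<Sum>i=1..N. f i) = (\<Sum>i=1..j. f i) + (\<Sum>i=Suc j..N. f i)" for f :: "nat \<Rightarrow> nat"
    using j sum.ub_add_nat[of 1 j f "N - j"] by simp
  have "(\<Sum>i=1..j. min s (\<kappa> i)) = (\<Sum>i=1..j. s)"
    using anti j by (intro sum.cong) (auto simp: s_def monotone_on_def min_def)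
  moreover have "(\<Sum>i=Suc j..N. min s (\<kappa> i)) = (\<Sum>i=Suc j..N. \<kappa> i)"
    using anti j by (intro sum.cong) (auto simp: s_def monotone_on_def min_def intro!: antisym)
  moreover have "(\<Sum>i=1..j. min s (\<mu> i)) \<le> (\<Sum>i=1..j. s)"
    by (intro sum_mono) simp
  moreover have "(\<Sum>i=Suc j..N. min s (\<mu> i)) \<le> (\<Sum>i=Suc j..N. \<mu> i)"
    by (intro sum_mono) simp
  ultimately show ?thesis
    using total min_le[of s] split[of \<kappa>] split[of \<mu>]
      split[of "\<lambda>i. min s (\<kappa> i)"] split[of "\<lambda>i. min s (\<mu> i)"] by linarith
qed

lemma partition_support:
  assumes "is_partition \<nu>" "{i \<in> {1..}. \<nu> i \<noteq> 0} \<subseteq> {1..N}"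
  shows "(\<Sum>i=1..N. \<nu> i) = weight \<nu>" "antimono_on {1..N} \<nu>"
  using assms unfolding weight_def is_partition_def
  by (auto intro!: sum.mono_neutral_right simp: monotone_on_def)

lemma dominates_iff_bounded:
  assumes "partition_of \<kappa> n" "partition_of \<mu> n"
    and "{i \<in> {1..}. \<kappa> i \<noteq> 0} \<subseteq> {1..N}" "{i \<in> {1..}. \<mu> i \<noteq> 0} \<subseteq> {1..N}"
  shows "dominates \<kappa> \<mu> \<longleftrightarrow> (\<forall>j\<in>{1..N}. (\<Sum>i=1..j. \<mu> i) \<le> (\<Sum>i=1..j. \<kappa> i))"
proof -
  \<comment> \<open>From \<open>N\<close> on, both partial sums equal \<open>n\<close>.\<close>
  have "(\<Sum>i=1..j. \<nu> i) = n" if "partition_of \<nu> n" "{i \<in> {1..}. \<nu> i \<noteq> 0} \<subseteq> {1..N}" "N \<le> j" for \<nu> j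
    using that partition_support(1)[of \<nu> j] by (force simp: partition_of_def)
  then show ?thesis
    using assms by (auto simp: dominates_def partition_of_def)
qed

section \<open>Supports\<close>

text \<open>At total degree \<open>d + e\<close> or beyond, every pair of exponents other than
  \<open>(d, e)\<close> exceeds one of the two degree bounds.\<close>

lemma fps_nth_mult_top:
  fixes F G :: "real fps"
  assumes "\<And>n. n > d \<Longrightarrow> fps_nth F n = 0" "\<And>n. n > e \<Longrightarrow> fps_nth G n = 0"
  shows "n > d + e \<Longrightarrow> fps_nth (F * G) n = 0" "fps_nth (F * G) (d + e) = fps_nth F d * fps_nth G e"
proof -
  have z: "fps_nth F a * fps_nth G (m - a) = 0" if "m \<ge> d + e" "m = d + e \<longrightarrow> a \<noteq> d" for a m
  proof -
    have "a > d \<or> m - a > e" using that by linarith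
    then show ?thesis using assms by auto
  qed
  then show "n > d + e \<Longrightarrow> fps_nth (F * G) n = 0" unfolding fps_mult_nth by (intro sum.neutral) auto
  have "(\<Sum>a=0..d+e. fps_nth F a * fps_nth G (d + e - a)) = (\<Sum>a\<in>{d}. fps_nth F a * fps_nth G (d + e - a))"
    using z[of "d + e"] by (intro sum.mono_neutral_right) auto
  then show "fps_nth (F * G) (d + e) = fps_nth F d * fps_nth G e" by (simp add: fps_mult_nth)
qed

lemma fps_nth_prod_top:
  fixes F :: "'i \<Rightarrow> real fps"
  assumes "finite I" "\<And>i n. i \<in> I \<Longrightarrow> n > d i \<Longrightarrow> fps_nth (F i) n = 0"
  shows "(\<forall>n > (\<Sum>i\<in>I. d i). fps_nth (\<Prod>i\<in>I. F i) n = 0)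
    \<and> fps_nth (\<Prod>i\<in>I. F i) (\<Sum>i\<in>I. d i) = (\<Prod>i\<in>I. fps_nth (F i) (d i))"
  using assms
proof (induction I)
  case (insert i I)
  then show ?case
    using fps_nth_mult_top[of "d i" "F i" "\<Sum>i\<in>I. d i" "\<Prod>i\<in>I. F i"] by auto
qed (simp add: fps_one_nth)

text \<open>Non-negative terms cannot cancel, so supports add: \<open>{0..r}\<close> and
  \<open>{0..r * m}\<close> give \<open>{0..r * Suc m}\<close>.\<close>

lemma fps_nth_power_support:
  assumes "fps_nonneg P" "\<And>a. 0 < fps_nth P a \<longleftrightarrow> a \<le> r"
  shows "0 < fps_nth (P ^ m) a \<longleftrightarrow> a \<le> r * m"
proof (induction m arbitrary: a)
  case (Suc m)
  have nn: "0 \<le> fps_nth P b * fps_nth (P ^ m) c" for b c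
    using assms(1) fps_nonneg_power[OF assms(1)] by (simp add: fps_nonneg_def)
  have pos: "0 < fps_nth P b * fps_nth (P ^ m) c \<longleftrightarrow> b \<le> r \<and> c \<le> r * m" for b c
    using assms(1) fps_nonneg_power[OF assms(1), of m]
    by (simp add: fps_nonneg_def zero_less_mult_iff not_less[symmetric] assms(2) Suc)
  have "0 < fps_nth (P ^ Suc m) a \<longleftrightarrow> (\<exists>b\<in>{0..a}. 0 < fps_nth P b * fps_nth (P ^ m) (a - b))"
    unfolding power_Suc fps_mult_nth using nn
    by (metis (no_types, lifting) finite_atLeastAtMost not_less order.antisym sum_nonneg_0 sum_pos2 sum_nonpos)
  also have "\<dots> \<longleftrightarrow> a \<le> r * Suc m"
    unfolding pos by (auto intro!: bexI[of _ "min a r"])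
  finally show ?case .
qed (auto simp: fps_one_nth)

section \<open>Independent sums\<close>

text \<open>Independence makes the law of a sum a convolution. Taking \<open>T = UNIV\<close> gives
  the laws of the row sums, \<open>T = {..t}\<close> the event \<open>E\<close>.\<close>

lemma (in prob_space) prob_indep_sum_eq_fps_nth:
  fixes Y :: "'i \<Rightarrow> 'a \<Rightarrow> nat"
  assumes "finite I" "indep_vars (\<lambda>_. count_space UNIV) Y I"
  shows "prob {\<omega> \<in> space M. (\<forall>i\<in>I. Y i \<omega> \<in> T) \<and> (\<Sum>i\<in>I. Y i \<omega>) = j}
    = fps_nth (\<Prod>i\<in>I. Abs_fps (\<lambda>a. if a \<in> T then prob {\<omega> \<in> space M. Y i \<omega> = a} else 0)) j"
  using assms
proof (induction I arbitrary: j)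
  case empty
  then show ?case by (simp add: prob_space fps_one_nth)
next
  case (insert i I)
  have [measurable]: "Y k \<in> measurable M (count_space UNIV)" if "k \<in> insert i I" for k
    using insert.prems that unfolding indep_vars_def by blast
  have ind: "indep_vars (\<lambda>_. count_space UNIV) Y I"
    using insert.prems by (rule indep_vars_subset) auto
  let ?Q = "\<lambda>i. Abs_fps (\<lambda>a. if a \<in> T then prob {\<omega> \<in> space M. Y i \<omega> = a} else 0)"
  \<comment> \<open>Including \<open>a \<in> T\<close> makes \<open>?A a\<close> empty outside
    \<open>T\<close>, matching the default 0 in \<open>?Q\<close>.\<close>
  let ?A = "\<lambda>a. {\<omega> \<in> space M. Y i \<omega> = a \<and> a \<in> T}"
  let ?B = "\<lambda>b. {\<omega> \<in> space M. (\<forall>k\<in>I. Y k \<omega> \<in> T) \<and> (\<Sum>k\<in>I. Y k \<omega>) = b}"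
  have sets: "?A a \<in> events" "?B b \<in> events" for a b
    using insert.hyps(1) by measurable
  have prod: "prob (?A a \<inter> ?B b) = prob (?A a) * prob (?B b)" for a b
  proof -
    let ?Mi = "PiM {i} (\<lambda>_. count_space (UNIV :: nat set))"
      and ?MI = "PiM I (\<lambda>_. count_space (UNIV :: nat set))"
    let ?R = "\<lambda>K \<omega>. restrict (\<lambda>k. Y k \<omega>) K"
    let ?A' = "{f \<in> space ?Mi. f i = a \<and> a \<in> T}"
    let ?B' = "{f \<in> space ?MI. (\<forall>k\<in>I. f k \<in> T) \<and> (\<Sum>k\<in>I. f k) = b}"
    \<comment> \<open>\<open>Y i\<close> must be independent of the whole family over
      \<open>I\<close>, hence the passage to random vectors.\<close>
    have "indep_var ?Mi (?R {i}) ?MI (?R I)"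
      using insert.hyps insert.prems by (intro indep_var_restrict) auto
    moreover have "?A' \<in> sets ?Mi" by measurable
    moreover have "?B' \<in> sets ?MI" using insert.hyps(1) by measurable
    ultimately have "prob ((\<lambda>\<omega>. (?R {i} \<omega>, ?R I \<omega>)) -` (?A' \<times> ?B') \<inter> space M)
        = prob (?R {i} -` ?A' \<inter> space M) * prob (?R I -` ?B' \<inter> space M)"
      by (rule indep_varD)
    moreover have "(\<lambda>\<omega>. (?R {i} \<omega>, ?R I \<omega>)) -` (?A' \<times> ?B') \<inter> space M = ?A a \<inter> ?B b"
      "?R {i} -` ?A' \<inter> space M = ?A a" "?R I -` ?B' \<inter> space M = ?B b"
      by (auto simp: space_PiM)
    ultimately show ?thesis by simp
  qed
  have "{\<omega> \<in> space M. (\<forall>k\<in>insert i I. Y k \<omega> \<in> T) \<and> (\<Sum>k\<in>insert i I. Y k \<omega>) = j}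
      = (\<Union>a\<in>{0..j}. ?A a \<inter> ?B (j - a))"
    using insert.hyps by auto
  also have "prob \<dots> = (\<Sum>a=0..j. prob (?A a \<inter> ?B (j - a)))"
    using sets by (intro finite_measure_finite_Union) (auto simp: disjoint_family_on_def)
  also have "\<dots> = (\<Sum>a=0..j. fps_nth (?Q i) a * fps_nth (\<Prod>k\<in>I. ?Q k) (j - a))"
    unfolding prod insert.IH[OF ind] by (intro sum.cong) auto
  also have "\<dots> = fps_nth (\<Prod>k\<in>insert i I. ?Q k) j"
    using insert.hyps by (simp add: fps_mult_nth)
  finally show ?case .
qed

lemma prob_row_sum:
  assumes "prob_space M" "X \<in> measurable M (count_space UNIV)"
  shows "measure (copies M X) {\<omega> \<in> space (copies M X). row_sum \<nu> i \<omega> = a}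
    = fps_nth (Abs_fps (prob_seq M X) ^ \<nu> i) a"
proof -
  interpret prob_space "copies M X" using assms by (rule prob_space_copies)
  have coord: "prob {\<omega> \<in> space (copies M X). \<omega> ik = b} = prob_seq M X b" for ik b
  proof -
    have "measure (distr (copies M X) (count_space UNIV) (\<lambda>\<omega>. \<omega> ik)) {b}
        = measure (distr M (count_space UNIV) X) {b}"
      by (simp add: distr_coordinate[OF assms])
    then show ?thesis
      using assms(2) measurable_coordinate[of ik M X]
      by (simp add: measure_distr prob_seq_def vimage_def Int_def conj_commute)
  qed
  have "indep_vars (\<lambda>_. count_space UNIV) (\<lambda>ik \<omega>. \<omega> ik) (Pair i ` {..<\<nu> i})"
    by (rule indep_vars_subset[OF indep_coordinates[OF assms]]) simp
  from prob_indep_sum_eq_fps_nth[OF _ this, of UNIV a] show ?thesis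
    by (simp add: row_sum_def coord sum.reindex card_image inj_on_def)
qed

lemma prob_event_E:
  assumes "prob_space M" "X \<in> measurable M (count_space UNIV)"
    and supp: "{i \<in> {1..}. \<nu> i \<noteq> 0} \<subseteq> {1..N}"
  shows "measure (copies M X) (event_E \<nu> M X j t)
    = fps_nth (\<Prod>i=1..N. fps_cutoff (Suc t) (Abs_fps (prob_seq M X) ^ \<nu> i)) j"
proof -
  interpret prob_space "copies M X" using assms(1,2) by (rule prob_space_copies)
  \<comment> \<open>Rows beyond \<open>N\<close> are empty sums, so the condition on all rows
    becomes a finite one.\<close>
  have zero: "row_sum \<nu> i \<omega> = 0" if "i \<ge> 1" "i \<notin> {1..N}" for i \<omega>
    proof -
    have "\<nu> i = 0" using that supp by blast
    then show ?thesis by (simp add: row_sum_def)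
  qed
  have bound: "(\<forall>i\<ge>1. row_sum \<nu> i \<omega> \<le> t) \<longleftrightarrow> (\<forall>i\<in>{1..N}. row_sum \<nu> i \<omega> \<in> {..t})" for \<omega>
    using zero by (metis atLeastAtMost_iff atMost_iff le0)
  have sum: "(\<Sum>i \<in> {i \<in> {1..}. \<nu> i \<noteq> 0}. row_sum \<nu> i \<omega>) = (\<Sum>i=1..N. row_sum \<nu> i \<omega>)" for \<omega>
    using supp by (intro sum.mono_neutral_left) (auto simp: row_sum_def)
  have "indep_vars (\<lambda>_. count_space UNIV) (row_sum \<nu>) {1..N}"
    using indep_row_sums[OF assms(1,2)] by (rule indep_vars_subset) simp
  from prob_indep_sum_eq_fps_nth[OF _ this, of "{..t}" j] show ?thesis
    unfolding event_E_def bound sum prob_row_sum[OF assms(1,2)]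
    by (simp add: fps_cutoff_def less_Suc_eq_le)
qed

section \<open>The equivalence\<close>

lemma prod_cutoff_mono:
  fixes \<kappa> \<mu> :: "nat \<Rightarrow> nat"
  assumes P: "toeplitz_tn2 P" "fps_nonneg P"
    and "antimono_on {1..N} \<mu>"
    and "\<And>j. j \<le> N \<Longrightarrow> (\<Sum>i=1..j. \<mu> i) \<le> (\<Sum>i=1..j. \<kappa> i)"
    and "(\<Sum>i=1..N. \<kappa> i) = (\<Sum>i=1..N. \<mu> i)"
  shows "fps_nth (\<Prod>i=1..N. fps_cutoff (Suc t) (P ^ \<kappa> i)) j
    \<le> fps_nth (\<Prod>i=1..N. fps_cutoff (Suc t) (P ^ \<mu> i)) j"
proof (rule dominance_box_moves[where \<Phi> = "\<lambda>\<nu> :: nat \<Rightarrow> nat. fps_nth (\<Prod>i=1..N. fps_cutoff (Suc t) (P ^ \<nu> i)) j"])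
  let ?W = "\<lambda>m. fps_cutoff (Suc t) (P ^ m)"
  show "fps_nth (\<Prod>i=1..N. ?W (\<nu> i)) j = fps_nth (\<Prod>i=1..N. ?W (\<nu>' i)) j"
    if "\<And>i. i \<in> {1..N} \<Longrightarrow> \<nu> i = \<nu>' i" for \<nu> \<nu>' :: "nat \<Rightarrow> nat"
    using that by simp
  fix \<nu> :: "nat \<Rightarrow> nat" and i k
  assume ik: "i \<in> {1..N}" "k \<in> {1..N}" and gap: "\<nu> k + 2 \<le> \<nu> i"
  let ?\<nu>' = "\<nu>(i := \<nu> i - 1, k := \<nu> k + 1)"
  let ?R = "\<Prod>h\<in>{1..N} - {i} - {k}. ?W (\<nu> h)"
  obtain m where m: "\<nu> i = Suc m" using gap by (cases "\<nu> i") auto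
  have "i \<noteq> k" using gap by auto
  have split: "(\<Prod>h=1..N. F h) = F i * F k * (\<Prod>h\<in>{1..N} - {i} - {k}. F h)" for F :: "nat \<Rightarrow> real fps"
    using ik \<open>i \<noteq> k\<close> prod.remove[of "{1..N}" i F] prod.remove[of "{1..N} - {i}" k F]
    by (simp add: mult.assoc)
  have "(\<Prod>h\<in>{1..N} - {i} - {k}. ?W (?\<nu>' h)) = ?R" by (intro prod.cong) auto
  \<comment> \<open>Only two factors change, and \<open>gap\<close> gives
    \<open>\<nu> k \<le> m\<close>, as \<open>cutoff_power_exchange\<close> requires.\<close>
  then have "(\<Prod>h=1..N. ?W (?\<nu>' h)) - (\<Prod>h=1..N. ?W (\<nu> h))
      = (?W (Suc (\<nu> k)) * ?W m - ?W (\<nu> k) * ?W (Suc m)) * ?R"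
    unfolding split using \<open>i \<noteq> k\<close> by (simp add: m algebra_simps del: power_Suc)
  also have "fps_nonneg \<dots>"
    using P gap m by (intro fps_nonneg_mult cutoff_power_exchange fps_nonneg_prod
      fps_nonneg_cutoff fps_nonneg_power) auto
  finally show "fps_nth (\<Prod>i=1..N. ?W (\<nu> i)) j \<le> fps_nth (\<Prod>i=1..N. ?W (?\<nu>' i)) j"
    by (simp add: fps_nonneg_def)
qed (use assms in auto)

text \<open>For \<open>t = r * s\<close> the truncation of \<open>P ^ m\<close> has degree exactly
  \<open>r * min s m\<close>. The positive top coefficient of the product for
  \<open>\<kappa>\<close> then bounds the degree of the one for \<open>\<mu>\<close> from
  below.\<close>

lemma sum_min_le_if_prod_cutoff_le:
  fixes \<kappa> \<mu> :: "nat \<Rightarrow> nat"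
  assumes P: "fps_nonneg P" "\<And>a. 0 < fps_nth P a \<longleftrightarrow> a \<le> r" and "r > 0"
    and le: "\<And>j t. fps_nth (\<Prod>i=1..N. fps_cutoff (Suc t) (P ^ \<kappa> i)) j
      \<le> fps_nth (\<Prod>i=1..N. fps_cutoff (Suc t) (P ^ \<mu> i)) j"
  shows "(\<Sum>i=1..N. min s (\<kappa> i)) \<le> (\<Sum>i=1..N. min s (\<mu> i))"
proof -
  let ?W = "\<lambda>m. fps_cutoff (Suc (r * s)) (P ^ m)"
  have supp: "fps_nth (?W m) a > 0 \<longleftrightarrow> a \<le> r * min s m" for m a
    using fps_nth_power_support[OF P] by (auto simp: nat_mult_min_right less_Suc_eq_le)
  have nn: "0 \<le> fps_nth (?W m) a" for m a
    using fps_nonneg_power[OF P(1), of m] by (simp add: fps_nonneg_def)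
  have vanish: "fps_nth (?W m) a = 0" if "a > r * min s m" for m a
    using supp[of m a] nn[of m a] that by simp
  have top: "(\<forall>n > (\<Sum>i=1..N. r * min s (\<nu> i)). fps_nth (\<Prod>i=1..N. ?W (\<nu> i)) n = 0)
      \<and> fps_nth (\<Prod>i=1..N. ?W (\<nu> i)) (\<Sum>i=1..N. r * min s (\<nu> i))
        = (\<Prod>i=1..N. fps_nth (?W (\<nu> i)) (r * min s (\<nu> i)))" for \<nu> :: "nat \<Rightarrow> nat"
    by (rule fps_nth_prod_top) (rule finite_atLeastAtMost, rule vanish)
  let ?d = "\<Sum>i=1..N. r * min s (\<kappa> i)"
  have "0 < (\<Prod>i=1..N. fps_nth (?W (\<kappa> i)) (r * min s (\<kappa> i)))"
    using supp by (intro prod_pos) blast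
  also have "\<dots> = fps_nth (\<Prod>i=1..N. ?W (\<kappa> i)) ?d"
    by (rule conjunct2[OF top, symmetric])
  also have "\<dots> \<le> fps_nth (\<Prod>i=1..N. ?W (\<mu> i)) ?d" by (rule le)
  finally have "0 < fps_nth (\<Prod>i=1..N. ?W (\<mu> i)) ?d" .
  then have "\<not> (\<Sum>i=1..N. r * min s (\<mu> i)) < ?d"
    using conjunct1[OF top, of \<mu>] by (metis less_irrefl)
  then show ?thesis using \<open>r > 0\<close> by (simp add: sum_distrib_left[symmetric])
qed

theorem theorem1:
  fixes M :: "'a measure" and X :: "'a \<Rightarrow> nat" and r n :: nat
    and \<kappa> \<mu> :: "nat \<Rightarrow> nat"
  assumes "prob_space M"
    and "X \<in> measurable M (count_space UNIV)"
    and "TN 2 (toeplitz (prob_seq M X))"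
    and "r > 0"
    and "rv_range M X = {0..r}"
    and "partition_of \<kappa> n"
    and "partition_of \<mu> n"
  shows "dominates \<kappa> \<mu> \<longleftrightarrow> cond_C \<kappa> \<mu> M X"
proof -
  let ?supp = "\<lambda>\<nu> :: nat \<Rightarrow> nat. {i \<in> {1..}. \<nu> i \<noteq> 0}"
  define P where "P = Abs_fps (prob_seq M X)"
  have tn: "toeplitz_tn2 P"
  proof (rule TN2_imp_toeplitz_tn2)
    have "fps_nth P = prob_seq M X" by (rule ext) (simp add: P_def)
    then show "TN 2 (toeplitz (fps_nth P))" using assms(3) by simp
  qed
  have nn: "fps_nonneg P" by (simp add: P_def fps_nonneg_def prob_seq_def)
  have pos: "0 < fps_nth P a \<longleftrightarrow> a \<le> r" for a
  proof -
    have "0 < fps_nth P a \<longleftrightarrow> a \<in> rv_range M X"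
      by (simp add: P_def rv_range_def prob_seq_def zero_less_measure_iff)
    then show ?thesis using assms(5) by simp
  qed
  have "finite (?supp \<kappa> \<union> ?supp \<mu>)"
    using assms(6,7) by (simp add: partition_of_def is_partition_def)
  \<comment> \<open>A common \<open>N\<close> pads both partitions with zero rows to the same
    length.\<close>
  then obtain N where "?supp \<kappa> \<union> ?supp \<mu> \<subseteq> {..N}"
    by (meson finite_nat_iff_bounded_le)
  then have supp: "?supp \<kappa> \<subseteq> {1..N}" "?supp \<mu> \<subseteq> {1..N}" by auto
  have anti: "antimono_on {1..N} \<kappa>" "antimono_on {1..N} \<mu>"
    and total: "(\<Sum>i=1..N. \<kappa> i) = (\<Sum>i=1..N. \<mu> i)"
    using partition_support supp assms(6,7) by (auto simp: partition_of_def)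
  have C: "cond_C \<kappa> \<mu> M X \<longleftrightarrow> (\<forall>j t. fps_nth (\<Prod>i=1..N. fps_cutoff (Suc t) (P ^ \<kappa> i)) j
      \<le> fps_nth (\<Prod>i=1..N. fps_cutoff (Suc t) (P ^ \<mu> i)) j)"
    unfolding cond_C_def P_def using prob_event_E[OF assms(1,2)] supp by simp
  note dom = dominates_iff_bounded[OF assms(6,7) supp]
  show ?thesis
  proof
    assume "dominates \<kappa> \<mu>"
    then have "(\<Sum>i=1..j. \<mu> i) \<le> (\<Sum>i=1..j. \<kappa> i)" if "j \<le> N" for j
      \<comment> \<open>Dominance speaks of \<open>j \<ge> 1\<close> only; at \<open>j = 0\<close>
        both sums are empty.\<close>
      using that dom by (cases "j = 0") auto
    then show "cond_C \<kappa> \<mu> M X"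
      unfolding C using prod_cutoff_mono[OF tn nn anti(2) _ total] by blast
  next
    assume "cond_C \<kappa> \<mu> M X"
    then have "(\<Sum>i=1..N. min s (\<kappa> i)) \<le> (\<Sum>i=1..N. min s (\<mu> i))" for s
      unfolding C using nn pos assms(4) by (intro sum_min_le_if_prod_cutoff_le) auto
    then show "dominates \<kappa> \<mu>"
      unfolding dom using dominance_if_sum_min_le[OF anti(1) total] by auto
  qed
qed

end
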